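(* Let $(G,S)$ be an irreducible Coxeter system (i.e. its Coxeter graph $\mathcal{G}$ is connected) with $S=\{s_0,\dots,s_{n-1}\}$ and Coxeter matrix $\mathfrak{m}=(m_{ij})_{0\le i,j\le n-1}$. For every pair $(i,j)$ with $0\le i<j\le n-1$ and $m_{ij}\neq 2$ (i.e. for every edge of $\mathcal{G}$, oriented from its smaller to its larger endpoint) introduce a generator $r_{ij}$, and write $r_{ji}:=r_{ij}^{-1}$. Then the alternating subgroup $G^+$ of $G$ is isomorphic to the group with generators $r_{ij}$ and the defining relations $$\left\{\begin{array}{ll} (r_{ij})^{m_{ij}}=1 & \text{for all generators } r_{ij},\\ r_{ii_1}r_{i_1i_2}\cdots r_{i_ai}=1 & \text{for cycles of } \mathcal{G} \text{ with edges } (i i_1),(i_1i_2),\dots,(i_ai),\\ (r_{ij}r_{jk})^2=1 & \text{for } r_{ij},r_{jk} \text{ such that } i<k \text{ and } m_{ik}=2,\\ (r_{ij}r_{jk}r_{kl})^2=1 & \text{for } r_{ij},r_{jk},r_{kl} \text{ such that } i<l \text{ and } m_{il}=2,\\ r_{ij}r_{lm}=r_{lm}r_{ij} & \text{for } r_{ij} \text{ and } r_{lm} \text{ which are not connected.} \end{array}\right.$$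
   Context: A Coxeter system $(G,S)$ with $S=\{s_0,\dots,s_{n-1}\}$ is given by a symmetric matrix $\mathfrak{m}=(m_{ij})_{i,j=0,\dots,n-1}$ with $m_{ii}=1$ and $m_{ij}\in\{2,3,\dots\}\cup\{\infty\}$ for $i\ne j$, and $G=\langle s_0,\dots,s_{n-1}\mid (s_is_j)^{m_{ij}}=1,\ i\le j\rangle$. A relation with exponent $m_{ij}=\infty$ is understood to be omitted (here and in the presentation of the claim). The Coxeter graph $\mathcal{G}$ has vertices $0,\dots,n-1$, with an edge between $i$ and $j$ if and only if $m_{ij}\ge 3$. The alternating subgroup is $G^+:=\ker(\epsilon)$, where $\epsilon:G\to\{-1,1\}$ is the homomorphism with $\epsilon(s_i)=-1$ for all $i$. In the relations, $r_{ij}$ may denote either a generator (if $i<j$) or the inverse of a generator (if $i>j$, $r_{ij}=r_{ji}^{-1}$); it is defined whenever $\{i,j\}$ is an edge of $\mathcal{G}$. Two generators $r_{ij}$ and $r_{lm}$ are said to be not connected if $\{i,j\}\cap\{l,m\}=\varnothing$ and there is no edge of $\mathcal{G}$ connecting any of the vertices $i,j$ with any of the vertices $l,m$. *)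

theory Defs
  imports
    "HOL-Library.Extended_Nat"
    "HOL-Library.FuncSet"
    "HOL-Algebra.Sym_Groups"
    "Graph_Theory.Digraph_Component"
begin

section \<open>Groups given by generators and relations\<close>

text \<open>
  The letter \<open>(x, True)\<close> stands for the generator \<open>x\<close> and \<open>(x, False)\<close> for its formal inverse.
  A relation \<open>u = v\<close> is the pair \<open>(u, v)\<close> of words.
\<close>

type_synonym 'g word = "('g \<times> bool) list"

definition words_over :: "'g set \<Rightarrow> 'g word set" where
  "words_over X = lists (X \<times> UNIV)"

lemma words_over_simps [simp]:
  "[] \<in> words_over X"
  "a # w \<in> words_over X \<longleftrightarrow> fst a \<in> X \<and> w \<in> words_over X"
  "u @ v \<in> words_over X \<longleftrightarrow> u \<in> words_over X \<and> v \<in> words_over X"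
  "rev w \<in> words_over X \<longleftrightarrow> w \<in> words_over X"
  by (cases a; auto simp: words_over_def)+

lemma words_over_map_inverse [simp]:
  "map (\<lambda>(x, b). (x, \<not> b)) w \<in> words_over X \<longleftrightarrow> w \<in> words_over X"
  by (induction w) (auto split: prod.splits)

definition word_pow :: "'g word \<Rightarrow> nat \<Rightarrow> 'g word" where
  "word_pow w k = concat (replicate k w)"

inductive pres_eq :: "'g set \<Rightarrow> ('g word \<times> 'g word) set \<Rightarrow> 'g word \<Rightarrow> 'g word \<Rightarrow> bool"
  for X :: "'g set" and R :: "('g word \<times> 'g word) set" where
  refl: "w \<in> words_over X \<Longrightarrow> pres_eq X R w w"
| sym: "pres_eq X R u v \<Longrightarrow> pres_eq X R v u"
| trans: "pres_eq X R u v \<Longrightarrow> pres_eq X R v w \<Longrightarrow> pres_eq X R u w"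
| cancel: "u \<in> words_over X \<Longrightarrow> v \<in> words_over X \<Longrightarrow> x \<in> X \<Longrightarrow>
    pres_eq X R (u @ [(x, b), (x, \<not> b)] @ v) (u @ v)"
| relation: "u \<in> words_over X \<Longrightarrow> v \<in> words_over X \<Longrightarrow> (p, q) \<in> R \<Longrightarrow>
    p \<in> words_over X \<Longrightarrow> q \<in> words_over X \<Longrightarrow>
    pres_eq X R (u @ p @ v) (u @ q @ v)"

definition pres_class :: "'g set \<Rightarrow> ('g word \<times> 'g word) set \<Rightarrow> 'g word \<Rightarrow> 'g word set" where
  "pres_class X R w = {v. pres_eq X R w v}"

definition presented_group :: "'g set \<Rightarrow> ('g word \<times> 'g word) set \<Rightarrow> 'g word set monoid" where
  "presented_group X R =
     \<lparr> carrier = pres_class X R ` words_over X,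
       monoid.mult = (\<lambda>A B. \<Union>u\<in>A. \<Union>v\<in>B. pres_class X R (u @ v)),
       one = pres_class X R [] \<rparr>"

abbreviation pres_gen :: "'g set \<Rightarrow> ('g word \<times> 'g word) set \<Rightarrow> 'g \<Rightarrow> 'g word set" where
  "pres_gen X R x \<equiv> pres_class X R [(x, True)]"

lemma pres_eq_words:
  "pres_eq X R u v \<Longrightarrow> u \<in> words_over X \<and> v \<in> words_over X"
  by (induction rule: pres_eq.induct) auto

lemma pres_eq_append_left:
  assumes "pres_eq X R u v" "w \<in> words_over X"
  shows "pres_eq X R (w @ u) (w @ v)"
  using assms
proof (induction rule: pres_eq.induct)
  case (cancel u v x b)
  then show ?case using pres_eq.cancel[of "w @ u" X v x R b] by auto
next
  case (relation u v p q)
  then show ?case using pres_eq.relation[of "w @ u" X v p q R] by auto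
next
  case (refl w')
  then show ?case by (simp add: pres_eq.refl)
next
  case (sym u v)
  from sym.IH[OF sym.prems] show ?case by (rule pres_eq.sym)
next
  case (trans u v w')
  from trans.IH(1)[OF trans.prems] trans.IH(2)[OF trans.prems] show ?case by (rule pres_eq.trans)
qed

lemma pres_eq_append_right:
  assumes "pres_eq X R u v" "w \<in> words_over X"
  shows "pres_eq X R (u @ w) (v @ w)"
  using assms
proof (induction rule: pres_eq.induct)
  case (cancel u v x b)
  then show ?case using pres_eq.cancel[of u X "v @ w" x R b] by auto
next
  case (relation u v p q)
  then show ?case using pres_eq.relation[of u X "v @ w" p q R] by auto
next
  case (refl w')
  then show ?case by (simp add: pres_eq.refl)
next
  case (sym u v)
  from sym.IH[OF sym.prems] show ?case by (rule pres_eq.sym)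
next
  case (trans u v w')
  from trans.IH(1)[OF trans.prems] trans.IH(2)[OF trans.prems] show ?case by (rule pres_eq.trans)
qed

lemma pres_eq_append:
  assumes "pres_eq X R u u'" "pres_eq X R v v'"
  shows "pres_eq X R (u @ v) (u' @ v')"
proof (rule pres_eq.trans)
  show "pres_eq X R (u @ v) (u' @ v)"
    by (rule pres_eq_append_right[OF assms(1)]) (simp add: pres_eq_words[OF assms(2)])
  show "pres_eq X R (u' @ v) (u' @ v')"
    by (rule pres_eq_append_left[OF assms(2)]) (simp add: pres_eq_words[OF assms(1)])
qed

lemma pres_class_eq_iff:
  assumes "u \<in> words_over X"
  shows "pres_class X R u = pres_class X R v \<longleftrightarrow> pres_eq X R u v"
proof
  assume "pres_class X R u = pres_class X R v"
  moreover have "u \<in> pres_class X R u"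
    using assms by (simp_all add: pres_class_def pres_eq.refl)
  ultimately have "pres_eq X R v u" by (simp add: pres_class_def)
  then show "pres_eq X R u v" by (rule pres_eq.sym)
next
  assume uv: "pres_eq X R u v"
  have "pres_eq X R u w \<longleftrightarrow> pres_eq X R v w" for w
    using pres_eq.trans[OF uv] pres_eq.trans[OF pres_eq.sym[OF uv]] by blast
  then show "pres_class X R u = pres_class X R v" by (simp add: pres_class_def)
qed

lemma carrier_presented_group:
  "carrier (presented_group X R) = pres_class X R ` words_over X"
  by (simp add: presented_group_def)

lemma one_presented_group: "\<one>\<^bsub>presented_group X R\<^esub> = pres_class X R []"
  by (simp add: presented_group_def)

lemma mult_presented_group:
  assumes "u \<in> words_over X" "v \<in> words_over X"
  shows "pres_class X R u \<otimes>\<^bsub>presented_group X R\<^esub> pres_class X R v = pres_class X R (u @ v)"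
proof -
  have *: "pres_class X R (u' @ v') = pres_class X R (u @ v)"
    if "u' \<in> pres_class X R u" "v' \<in> pres_class X R v" for u' v'
  proof -
    have "pres_eq X R (u @ v) (u' @ v')"
      using that by (simp add: pres_class_def pres_eq_append)
    then show ?thesis
      using assms pres_class_eq_iff[of "u @ v" X R "u' @ v'"] by auto
  qed
  have ne: "pres_class X R u \<noteq> {}" "pres_class X R v \<noteq> {}"
    using assms pres_eq.refl by (auto simp: pres_class_def)
  have "pres_class X R u \<otimes>\<^bsub>presented_group X R\<^esub> pres_class X R v =
      (\<Union>u'\<in>pres_class X R u. \<Union>v'\<in>pres_class X R v. pres_class X R (u' @ v'))"
    by (simp add: presented_group_def)
  also have "\<dots> = (\<Union>u'\<in>pres_class X R u. \<Union>v'\<in>pres_class X R v. pres_class X R (u @ v))"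
    by (intro SUP_cong HOL.refl) (rule *)
  also have "\<dots> = pres_class X R (u @ v)"
    using ne by simp
  finally show ?thesis .
qed

lemma pres_eq_inverse:
  assumes "w \<in> words_over X"
  shows "pres_eq X R (rev (map (\<lambda>(x, b). (x, \<not> b)) w) @ w) []"
  using assms
proof (induction w)
  case Nil
  then show ?case by (simp add: pres_eq.refl)
next
  case (Cons a w)
  obtain x b where a: "a = (x, b)" by force
  let ?i = "rev (map (\<lambda>(x, b). (x, \<not> b)) w)"
  have "?i \<in> words_over X" "w \<in> words_over X" "x \<in> X"
    using Cons.prems a by simp_all
  then have "pres_eq X R (?i @ [(x, \<not> b), (x, \<not> \<not> b)] @ w) (?i @ w)"
    by (intro pres_eq.cancel)
  moreover have "pres_eq X R (?i @ w) []" using Cons by simp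
  ultimately have "pres_eq X R (?i @ [(x, \<not> b), (x, \<not> \<not> b)] @ w) []"
    by (rule pres_eq.trans)
  then show ?case using a by simp
qed

lemma group_presented_group: "group (presented_group X R)"
proof (rule groupI)
  fix A assume "A \<in> carrier (presented_group X R)"
  then obtain w where w: "w \<in> words_over X" "A = pres_class X R w"
    by (auto simp: carrier_presented_group)
  let ?i = "rev (map (\<lambda>(x, b). (x, \<not> b)) w)"
  have i: "?i \<in> words_over X" using w(1) by simp
  have "pres_class X R ?i \<otimes>\<^bsub>presented_group X R\<^esub> A = \<one>\<^bsub>presented_group X R\<^esub>"
    using w i pres_eq_inverse[OF w(1), of R]
    by (simp add: mult_presented_group one_presented_group pres_class_eq_iff)
  then show "\<exists>B\<in>carrier (presented_group X R). B \<otimes>\<^bsub>presented_group X R\<^esub> A = \<one>\<^bsub>presented_group X R\<^esub>"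
    using i by (auto simp: carrier_presented_group)
qed (auto simp only: carrier_presented_group one_presented_group mult_presented_group
    words_over_simps append_assoc append_Nil intro!: imageI)

fun word_val :: "('a, 'c) monoid_scheme \<Rightarrow> ('g \<Rightarrow> 'a) \<Rightarrow> 'g word \<Rightarrow> 'a" where
  "word_val H f [] = \<one>\<^bsub>H\<^esub>"
| "word_val H f ((x, b) # w) = (if b then f x else inv\<^bsub>H\<^esub> f x) \<otimes>\<^bsub>H\<^esub> word_val H f w"

context group
begin

lemma word_val_closed:
  "f \<in> X \<rightarrow> carrier G \<Longrightarrow> w \<in> words_over X \<Longrightarrow> word_val G f w \<in> carrier G"
proof (induction w)
  case (Cons a w)
  obtain x b where a: "a = (x, b)" by force
  with Cons have "x \<in> X" by simp
  then have "f x \<in> carrier G" using Cons.prems(1) by blast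
  with Cons a show ?case by simp
qed simp

lemma word_val_append:
  "f \<in> X \<rightarrow> carrier G \<Longrightarrow> u \<in> words_over X \<Longrightarrow> v \<in> words_over X \<Longrightarrow>
    word_val G f (u @ v) = word_val G f u \<otimes> word_val G f v"
proof (induction u)
  case (Cons a u)
  then obtain x b where a: "a = (x, b)" "x \<in> X" by (cases a) auto
  then have "f x \<in> carrier G" using Cons.prems(1) by blast
  with Cons a show ?case by (simp add: m_assoc word_val_closed)
qed (simp add: word_val_closed)

lemma word_val_pres_eq:
  assumes f: "f \<in> X \<rightarrow> carrier G"
    and R: "\<And>p q. (p, q) \<in> R \<Longrightarrow> p \<in> words_over X \<Longrightarrow> q \<in> words_over X \<Longrightarrow>
      word_val G f p = word_val G f q"
    and "pres_eq X R u v"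
  shows "word_val G f u = word_val G f v"
  using assms(3)
proof (induction rule: pres_eq.induct)
  case (cancel u v x b)
  have fx: "f x \<in> carrier G" using f cancel by blast
  have "word_val G f [(x, b), (x, \<not> b)] = \<one>" using fx by simp
  moreover have "[(x, b), (x, \<not> b)] \<in> words_over X" using cancel by auto
  moreover have "[(x, b), (x, \<not> b)] @ v \<in> words_over X" using cancel by simp
  ultimately show ?case
    using cancel(1,2) by (simp only: word_val_append[OF f] word_val_closed[OF f] l_one)
next
  case (relation u v p q)
  then show ?case using R[of p q] by (simp add: word_val_append[OF f])
qed simp_all

text \<open>The universal property of the group defined by a presentation.\<close>

lemma presented_group_universal:
  assumes f: "f \<in> X \<rightarrow> carrier G"
    and R: "\<And>p q. (p, q) \<in> R \<Longrightarrow> p \<in> words_over X \<Longrightarrow> q \<in> words_over X \<Longrightarrow>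
      word_val G f p = word_val G f q"
  shows "\<exists>!h. h \<in> hom (presented_group X R) G \<and> h \<in> extensional (carrier (presented_group X R)) \<and>
    (\<forall>x\<in>X. h (pres_gen X R x) = f x)"
proof (rule ex_ex1I)
  let ?P = "presented_group X R"
  define h where "h = restrict (\<lambda>A. word_val G f (SOME w. w \<in> A)) (carrier ?P)"
  have h: "h (pres_class X R w) = word_val G f w" if w: "w \<in> words_over X" for w
  proof -
    have "w \<in> pres_class X R w" using w by (simp add: pres_class_def pres_eq.refl)
    then have "(SOME v. v \<in> pres_class X R w) \<in> pres_class X R w" by (rule someI)
    then have "pres_eq X R w (SOME v. v \<in> pres_class X R w)" by (simp add: pres_class_def)
    from word_val_pres_eq[OF f R this] show ?thesis
      using w by (simp add: h_def carrier_presented_group)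
  qed
  have "h \<in> hom ?P G"
  proof (rule homI)
    fix A assume "A \<in> carrier ?P"
    then obtain u where u: "u \<in> words_over X" "A = pres_class X R u"
      by (auto simp only: carrier_presented_group)
    then show "h A \<in> carrier G" by (simp only: h word_val_closed[OF f])
    fix B assume "B \<in> carrier ?P"
    then obtain v where v: "v \<in> words_over X" "B = pres_class X R v"
      by (auto simp only: carrier_presented_group)
    have "u @ v \<in> words_over X" using u v by simp
    with u v show "h (A \<otimes>\<^bsub>?P\<^esub> B) = h A \<otimes> h B"
      by (simp only: h mult_presented_group word_val_append[OF f])
  qed
  moreover have "h \<in> extensional (carrier ?P)" by (simp add: h_def)
  moreover have "h (pres_gen X R x) = f x" if "x \<in> X" for x
  proof -
    have "f x \<in> carrier G" using that f by blast
    then show ?thesis using that by (simp add: h)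
  qed
  ultimately show "\<exists>h. h \<in> hom ?P G \<and> h \<in> extensional (carrier ?P) \<and>
    (\<forall>x\<in>X. h (pres_gen X R x) = f x)" by blast
next
  let ?P = "presented_group X R"
  interpret P: group ?P by (rule group_presented_group)
  fix g h
  assume g: "g \<in> hom ?P G \<and> g \<in> extensional (carrier ?P) \<and> (\<forall>x\<in>X. g (pres_gen X R x) = f x)"
    and h: "h \<in> hom ?P G \<and> h \<in> extensional (carrier ?P) \<and> (\<forall>x\<in>X. h (pres_gen X R x) = f x)"
  have val: "k (pres_class X R w) = word_val G f w"
    if k: "k \<in> hom ?P G" "\<forall>x\<in>X. k (pres_gen X R x) = f x" and w: "w \<in> words_over X" for k w
  proof -
    interpret k: group_hom ?P G k
      using k group_presented_group is_group by (simp add: group_hom_def group_hom_axioms_def)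
    show ?thesis using w
    proof (induction w)
      case Nil
      then show ?case using k.hom_one by (simp add: one_presented_group)
    next
      case (Cons a w)
      obtain x b where a: "a = (x, b)" by force
      with Cons.prems have x: "x \<in> X" and w: "w \<in> words_over X" by simp_all
      have gen: "pres_gen X R x \<in> carrier ?P" "pres_class X R w \<in> carrier ?P"
        using x w by (auto simp: carrier_presented_group)
      have letter: "k (pres_class X R [a]) = (if b then f x else inv f x)"
      proof (cases b)
        case True
        then show ?thesis using k(2) x a by simp
      next
        case False
        have "pres_eq X R ([] @ [(x, False), (x, \<not> False)] @ []) ([] @ [])"
          using x by (intro pres_eq.cancel) auto
        then have "pres_class X R [a] \<otimes>\<^bsub>?P\<^esub> pres_gen X R x = \<one>\<^bsub>?P\<^esub>"
          using a x False
          by (simp add: mult_presented_group one_presented_group pres_class_eq_iff)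
        moreover have "pres_class X R [a] \<in> carrier ?P"
          using a x by (auto simp: carrier_presented_group)
        ultimately have "pres_class X R [a] = inv\<^bsub>?P\<^esub> (pres_gen X R x)"
          using gen P.inv_equality by metis
        then show ?thesis using False gen k(2) x by simp
      qed
      have "pres_class X R (a # w) = pres_class X R [a] \<otimes>\<^bsub>?P\<^esub> pres_class X R w"
        using a x w by (simp add: mult_presented_group)
      moreover have "pres_class X R [a] \<in> carrier ?P"
        using a x by (auto simp: carrier_presented_group)
      ultimately show ?case using Cons gen letter a by simp
    qed
  qed
  show "g = h"
  proof (rule extensionalityI[of _ "carrier ?P"])
    fix A assume "A \<in> carrier ?P"
    then show "g A = h A" using val[of g] val[of h] g h by (auto simp: carrier_presented_group)
  qed (use g h in auto)
qed

end

section \<open>Coxeter groups and their alternating subgroups\<close>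

definition coxeter_matrix :: "nat \<Rightarrow> (nat \<Rightarrow> nat \<Rightarrow> enat) \<Rightarrow> bool" where
  "coxeter_matrix n m \<longleftrightarrow>
     (\<forall>i<n. \<forall>j<n. m i j = m j i) \<and>
     (\<forall>i<n. m i i = 1) \<and>
     (\<forall>i<n. \<forall>j<n. i \<noteq> j \<longrightarrow> 2 \<le> m i j)"

definition coxeter_relations :: "nat \<Rightarrow> (nat \<Rightarrow> nat \<Rightarrow> enat) \<Rightarrow> (nat word \<times> nat word) set" where
  "coxeter_relations n m =
     {(word_pow [(i, True), (j, True)] k, []) | i j k. i \<le> j \<and> j < n \<and> m i j = enat k}"

definition coxeter_group :: "nat \<Rightarrow> (nat \<Rightarrow> nat \<Rightarrow> enat) \<Rightarrow> nat word set monoid" where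
  "coxeter_group n m = presented_group {..<n} (coxeter_relations n m)"

definition coxeter_gen :: "nat \<Rightarrow> (nat \<Rightarrow> nat \<Rightarrow> enat) \<Rightarrow> nat \<Rightarrow> nat word set" where
  "coxeter_gen n m i = pres_gen {..<n} (coxeter_relations n m) i"

text \<open>
  As usual in \<^theory>\<open>Graph_Theory.Digraph_Component\<close>, an undirected graph is a symmetric digraph:
  an edge between \<open>i\<close> and \<open>j\<close> is represented by the two arcs \<open>(i, j)\<close> and \<open>(j, i)\<close>.
\<close>

definition coxeter_graph :: "nat \<Rightarrow> (nat \<Rightarrow> nat \<Rightarrow> enat) \<Rightarrow> nat pair_pre_digraph" where
  "coxeter_graph n m =
     \<lparr> pverts = {..<n}, parcs = {(i, j). i < n \<and> j < n \<and> i \<noteq> j \<and> 3 \<le> m i j} \<rparr>"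

definition irreducible_coxeter :: "nat \<Rightarrow> (nat \<Rightarrow> nat \<Rightarrow> enat) \<Rightarrow> bool" where
  "irreducible_coxeter n m \<longleftrightarrow> Digraph_Component.connected (with_proj (coxeter_graph n m))"

text \<open>
  \<^const>\<open>sign_img\<close> is the group \<open>{-1, 1}\<close>. The restriction to extensional functions only fixes the
  values outside the carrier, which makes the homomorphism unique as a HOL function;
  \<open>coxeter_sign_ex1\<close> below shows that the description is proper.
\<close>

definition coxeter_sign :: "nat \<Rightarrow> (nat \<Rightarrow> nat \<Rightarrow> enat) \<Rightarrow> nat word set \<Rightarrow> int" where
  "coxeter_sign n m =
     (THE e. e \<in> hom (coxeter_group n m) sign_img \<and> e \<in> extensional (carrier (coxeter_group n m)) \<and>
        (\<forall>i<n. e (coxeter_gen n m i) = -1))"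

definition alternating_subgroup :: "nat \<Rightarrow> (nat \<Rightarrow> nat \<Rightarrow> enat) \<Rightarrow> nat word set monoid" where
  "alternating_subgroup n m =
     (coxeter_group n m)
       \<lparr> carrier := kernel (coxeter_group n m) sign_img (coxeter_sign n m) \<rparr>"

lemma group_sign_img: "group sign_img"
  by (rule groupI) (auto simp: sign_img_def)

lemma coxeter_sign_ex1:
  "\<exists>!e. e \<in> hom (coxeter_group n m) sign_img \<and> e \<in> extensional (carrier (coxeter_group n m)) \<and>
     (\<forall>i<n. e (coxeter_gen n m i) = -1)"
proof -
  interpret group sign_img by (rule group_sign_img)
  let ?f = "\<lambda>_::nat. -1::int"
  have f: "?f \<in> {..<n} \<rightarrow> carrier sign_img" by (simp add: sign_img_def)
  have pair: "[(i, True), (j, True)] \<in> words_over {..<n}" if "i < n" "j < n" for i j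
    using that by auto
  have pow: "word_val sign_img ?f (word_pow [(i, True), (j, True)] k) = 1" for i j k
    by (induction k) (auto simp: word_pow_def sign_img_def)
  have "word_val sign_img ?f p = word_val sign_img ?f q"
    if "(p, q) \<in> coxeter_relations n m" for p q
    using that pow by (auto simp: coxeter_relations_def sign_img_def)
  then show ?thesis
    using presented_group_universal[OF f, of "coxeter_relations n m"]
    unfolding coxeter_group_def coxeter_gen_def Ball_def lessThan_iff by blast
qed

lemma coxeter_sign:
  "coxeter_sign n m \<in> hom (coxeter_group n m) sign_img"
  "i < n \<Longrightarrow> coxeter_sign n m (coxeter_gen n m i) = -1"
  using theI'[OF coxeter_sign_ex1, of n m] unfolding coxeter_sign_def by blast+

section \<open>The presentation on the edges of the Coxeter graph\<close>

definition edge_gens :: "nat \<Rightarrow> (nat \<Rightarrow> nat \<Rightarrow> enat) \<Rightarrow> (nat \<times> nat) set" where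
  "edge_gens n m = {(i, j). i < j \<and> j < n \<and> m i j \<noteq> 2}"

text \<open>
  The letter \<open>r\<^sub>i\<^sub>j\<close>: the generator \<open>(i, j)\<close> if \<open>i < j\<close>, and the formal inverse of the
  generator \<open>(j, i)\<close> if \<open>j < i\<close>.
\<close>

definition edge_letter :: "nat \<Rightarrow> nat \<Rightarrow> (nat \<times> nat) \<times> bool" where
  "edge_letter i j = (if i < j then ((i, j), True) else ((j, i), False))"

definition not_connected ::
    "nat \<Rightarrow> (nat \<Rightarrow> nat \<Rightarrow> enat) \<Rightarrow> nat \<times> nat \<Rightarrow> nat \<times> nat \<Rightarrow> bool" where
  "not_connected n m = (\<lambda>(i, j) (l, h).
     {i, j} \<inter> {l, h} = {} \<and>
     (\<forall>a\<in>{i, j}. \<forall>b\<in>{l, h}. (a, b) \<notin> parcs (coxeter_graph n m)))"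

text \<open>
  A cycle is given by its list of arcs \<open>(i, i\<^sub>1), (i\<^sub>1, i\<^sub>2), \<dots>, (i\<^sub>a, i)\<close>. The bound on the length
  excludes the closed walks \<open>(i, j), (j, i)\<close>, which are cycles of the symmetric digraph but not of
  the undirected graph.
\<close>

definition edge_relations ::
    "nat \<Rightarrow> (nat \<Rightarrow> nat \<Rightarrow> enat) \<Rightarrow> ((nat \<times> nat) word \<times> (nat \<times> nat) word) set" where
  "edge_relations n m = (let r = edge_letter; E = parcs (coxeter_graph n m) in
     {(word_pow [r i j] k, []) | i j k.
        (i, j) \<in> edge_gens n m \<and> m i j = enat k} \<union>
     {(map (\<lambda>(i, j). r i j) c, []) | c.
        pre_digraph.cycle (with_proj (coxeter_graph n m)) c \<and> 3 \<le> length c} \<union>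
     {(word_pow [r i j, r j k] 2, []) | i j k.
        (i, j) \<in> E \<and> (j, k) \<in> E \<and> i < k \<and> m i k = 2} \<union>
     {(word_pow [r i j, r j k, r k l] 2, []) | i j k l.
        (i, j) \<in> E \<and> (j, k) \<in> E \<and> (k, l) \<in> E \<and> i < l \<and> m i l = 2} \<union>
     {([r i j, r l h], [r l h, r i j]) | i j l h.
        (i, j) \<in> E \<and> (l, h) \<in> E \<and> not_connected n m (i, j) (l, h)})"

end

theory Submission
  imports Defs
begin

text \<open>
  Write \<open>W\<close> for the Coxeter group and \<open>Q\<close> for the group presented on the edges. Sending \<open>r\<^sub>i\<^sub>j\<close>
  to \<open>s\<^sub>i s\<^sub>j\<close> respects all edge relations and takes values in words of even length, so it
  gives a homomorphism \<open>h\<close> from \<open>Q\<close> to the alternating subgroup. The point is to recover a word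
  of \<open>Q\<close> from the element of \<open>W\<close> that it represents.

  The cycle relations make the product of the \<open>r\<^sub>i\<^sub>j\<close> along a walk depend on the end points only
  (\<open>closed_walk_val_eq_one\<close>), so in a connected graph there are elements \<open>t\<^sub>i\<close> of \<open>Q\<close>, the products
  along walks from \<open>0\<close> to \<open>i\<close>, with \<open>r\<^sub>i\<^sub>j = t\<^sub>i\<inverse> t\<^sub>j\<close> on every edge (\<open>potential_ex\<close>). The element
  \<open>d\<^sub>i\<^sub>j = t\<^sub>i\<inverse> t\<^sub>j\<close> makes sense for all pairs of vertices and plays the role of \<open>s\<^sub>i s\<^sub>j\<close>.
  It satisfies \<open>d\<^sub>i\<^sub>j ^ m\<^sub>i\<^sub>j = 1\<close> also when \<open>i\<close> and \<open>j\<close> are not adjacent: if they are at distance two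
  or three this is one of the relations, and larger distances follow by induction with the
  commutation relations, which let the first and the last arc of a long walk commute
  (\<open>diff_square_eq_one\<close>).

  Now map a word \<open>s\<^sub>a s\<^sub>b s\<^sub>c s\<^sub>d \<dots>\<close> to \<open>t\<^sub>a\<inverse> t\<^sub>b t\<^sub>c\<inverse> t\<^sub>d \<dots>\<close>, with exponents that alternate.
  Because of \<open>d\<^sub>i\<^sub>j ^ m\<^sub>i\<^sub>j = 1\<close> this value depends on the element of \<open>W\<close> only
  (\<open>alt_val_pres_eq\<close>). It undoes \<open>h\<close>, whence \<open>h\<close> is injective. Since \<open>h\<close> maps \<open>t\<^sub>i\<close> to
  \<open>s\<^sub>0 s\<^sub>i\<close> by telescoping along a walk, every word \<open>w\<close> of even length represents the image under
  \<open>h\<close> of its alternating value, whence \<open>h\<close> is onto the alternating subgroup.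
\<close>

section \<open>Evaluating words in a group\<close>

lemma word_pow_Suc: "word_pow w (Suc k) = w @ word_pow w k"
  by (simp add: word_pow_def)

lemma word_pow_0: "word_pow w 0 = []"
  by (simp add: word_pow_def)

lemma word_pow_in_words_over: "w \<in> words_over X \<Longrightarrow> word_pow w k \<in> words_over X"
  by (induction k) (auto simp: word_pow_0 word_pow_Suc)

lemma length_word_pow: "length (word_pow w k) = k * length w"
  by (induction k) (simp_all add: word_pow_0 word_pow_Suc)

context group
begin

lemma word_val_pow:
  assumes "f \<in> X \<rightarrow> carrier G" "w \<in> words_over X"
  shows "word_val G f (word_pow w k) = word_val G f w [^] k"
proof (induction k)
  case (Suc k)
  have "word_val G f (word_pow w (Suc k)) = word_val G f w \<otimes> word_val G f (word_pow w k)"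
    using assms by (simp add: word_pow_Suc word_val_append word_pow_in_words_over)
  also have "\<dots> = word_val G f w [^] Suc k"
    using Suc assms by (simp only: nat_pow_Suc2 word_val_closed)
  finally show ?case .
qed (simp add: word_pow_0)

text \<open>
  The homomorphism of the universal property, described on arbitrary words and not only on generators.
\<close>

lemma presented_group_hom_ex:
  assumes f: "f \<in> X \<rightarrow> carrier G"
    and R: "\<And>p q. (p, q) \<in> R \<Longrightarrow> p \<in> words_over X \<Longrightarrow> q \<in> words_over X \<Longrightarrow>
      word_val G f p = word_val G f q"
  shows "\<exists>h. h \<in> hom (presented_group X R) G \<and>
    (\<forall>w\<in>words_over X. h (pres_class X R w) = word_val G f w)"
proof -
  define h where "h A = word_val G f (SOME w. w \<in> A)" for A
  have h: "h (pres_class X R w) = word_val G f w" if w: "w \<in> words_over X" for w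
  proof -
    have "pres_eq X R w (SOME v. v \<in> pres_class X R w)"
      using w pres_eq.refl[of w X R] someI[of "\<lambda>v. v \<in> pres_class X R w" w]
      by (simp add: pres_class_def)
    from word_val_pres_eq[OF f R this] show ?thesis by (simp add: h_def)
  qed
  moreover have "h \<in> hom (presented_group X R) G"
    by (rule homI)
      (auto simp: carrier_presented_group mult_presented_group h word_val_closed[OF f]
        word_val_append[OF f])
  ultimately show ?thesis by blast
qed

lemma pow_mult_commute_eq_one:
  assumes "x \<in> carrier G" "y \<in> carrier G" "(x \<otimes> y) [^] (k::nat) = \<one>"
  shows "(y \<otimes> x) [^] k = \<one>"
proof -
  have "y \<otimes> (x \<otimes> y) [^] k = (y \<otimes> x) [^] k \<otimes> y" for k :: nat
    using assms(1,2) by (induction k) (simp_all add: m_assoc flip: m_assoc[of y "(x \<otimes> y) [^] _"])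
  from this[of k] show ?thesis using assms by (simp add: one_unique)
qed

text \<open>
  Since \<open>y\<close>, \<open>x y\<close> and \<open>y z\<close> square to one, \<open>x y x\<close> and \<open>z y z\<close> both equal \<open>y\<close>, and exchanging
  the inner \<open>z\<close> and \<open>x\<close> turns \<open>(x y z)\<^sup>2\<close> into \<open>(x y x) (z y z) = y\<^sup>2\<close>. This is the algebra behind
  the inductive step of \<open>diff_square_eq_one\<close> below.
\<close>

lemma square_mult3_eq_one:
  assumes c: "x \<in> carrier G" "y \<in> carrier G" "z \<in> carrier G"
    and xz: "x \<otimes> z = z \<otimes> x"
    and y: "y \<otimes> y = \<one>"
    and xy: "(x \<otimes> y) \<otimes> (x \<otimes> y) = \<one>"
    and yz: "(y \<otimes> z) \<otimes> (y \<otimes> z) = \<one>"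
  shows "(x \<otimes> y \<otimes> z) \<otimes> (x \<otimes> y \<otimes> z) = \<one>"
proof -
  have invy: "inv y = y" using y c by (simp add: inv_equality)
  have "(x \<otimes> y \<otimes> x) \<otimes> y = \<one>" using xy c by (simp add: m_assoc)
  then have 1: "x \<otimes> y \<otimes> x = y" using c invy by (metis inv_equality m_closed inv_inv)
  have "y \<otimes> (z \<otimes> y \<otimes> z) = \<one>" using yz c by (simp add: m_assoc)
  then have 2: "z \<otimes> y \<otimes> z = y" using c invy by (metis inv_equality m_closed inv_inv)
  have "(x \<otimes> y \<otimes> z) \<otimes> (x \<otimes> y \<otimes> z) = x \<otimes> y \<otimes> (z \<otimes> x) \<otimes> y \<otimes> z"
    using c by (simp add: m_assoc)
  also have "\<dots> = (x \<otimes> y \<otimes> x) \<otimes> (z \<otimes> y \<otimes> z)"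
    using c by (simp only: xz[symmetric]) (simp add: m_assoc)
  finally show ?thesis by (simp add: 1 2 y)
qed

end

lemma pres_class_eq_word_val:
  assumes "w \<in> words_over X"
  shows "pres_class X R w = word_val (presented_group X R) (pres_gen X R) w"
proof -
  interpret P: group "presented_group X R" by (rule group_presented_group)
  have gen: "pres_gen X R \<in> X \<rightarrow> carrier (presented_group X R)"
    by (auto simp: carrier_presented_group)
  have letter: "pres_class X R [(x, b)] =
      (if b then pres_gen X R x else inv\<^bsub>presented_group X R\<^esub> pres_gen X R x)"
    if x: "x \<in> X" for x b
  proof (cases b)
    case False
    have "pres_eq X R ([] @ [(x, False), (x, \<not> False)] @ []) ([] @ [])"
      using x by (intro pres_eq.cancel) auto
    then have "pres_class X R [(x, False)] \<otimes>\<^bsub>presented_group X R\<^esub> pres_gen X R x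
        = \<one>\<^bsub>presented_group X R\<^esub>"
      using x by (simp add: mult_presented_group one_presented_group pres_class_eq_iff)
    moreover have "pres_class X R [(x, False)] \<in> carrier (presented_group X R)"
      using x by (auto simp: carrier_presented_group)
    ultimately show ?thesis using False x gen by (simp add: P.inv_equality Pi_iff)
  qed simp
  show ?thesis using assms
  proof (induction w)
    case (Cons a w)
    then have "pres_class X R (a # w) =
        pres_class X R [a] \<otimes>\<^bsub>presented_group X R\<^esub> pres_class X R w"
      using mult_presented_group[of "[a]" X w R] by simp
    then show ?case using Cons letter by (cases a) auto
  qed (simp add: one_presented_group)
qed

section \<open>Closed walks\<close>

text \<open>
  A closed walk that is not a cycle passes through some vertex twice, not counting its final return
  to the start, so a shorter closed walk \<open>r\<close> can be cut out of it.
\<close>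

lemma (in wf_digraph) closed_walk_induct [consumes 1, case_names Nil cycle insert]:
  assumes "awalk u p u"
    and Nil: "Q []"
    and cycle: "\<And>c. cycle c \<Longrightarrow> Q c"
    and insert: "\<And>q r s v w. awalk v q w \<Longrightarrow> awalk w r w \<Longrightarrow> awalk w s v \<Longrightarrow> Q r \<Longrightarrow> Q (q @ s) \<Longrightarrow>
      Q (q @ r @ s)"
  shows "Q p"
  using assms(1)
proof (induction "length p" arbitrary: u p rule: less_induct)
  case less
  show ?case
  proof (cases p)
    case Nil
    then show ?thesis using assms(2) by simp
  next
    case (Cons e es)
    \<comment> \<open>The start of \<open>p\<close> is excluded from the test because it recurs as the end; hence the first
      arc \<open>e\<close> is set aside and the repeated vertex is sought in the walk \<open>es\<close>.\<close>
    show ?thesis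
    proof (cases "distinct (tl (awalk_verts u p))")
      case True
      then have "cycle p" using less.prems Cons by (auto simp: cycle_def)
      then show ?thesis by (rule cycle)
    next
      case False
      have walk: "awalk (head G e) es u" and e: "tail G e = u" "e \<in> arcs G"
        using less.prems Cons by (auto simp: awalk_Cons_iff)
      have "\<not> distinct (awalk_verts (head G e) es)" using False Cons by simp
      from awalk_not_distinct_decomp[OF walk this] obtain q r s w where
        d: "es = q @ r @ s" "0 < length r" "awalk (head G e) q w" "awalk w r w" "awalk w s u"
        by blast
      have q: "awalk u (e # q) w" using d e by (auto simp: awalk_Cons_iff)
      have "Q r" using less.hyps[of r w] d Cons by simp
      moreover have "Q ((e # q) @ s)"
        using less.hyps[of "(e # q) @ s" u] d Cons awalk_appendI[OF q d(5)] by simp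
      ultimately have "Q ((e # q) @ r @ s)" using insert[OF q d(4,5)] by blast
      then show ?thesis using Cons d by simp
    qed
  qed
qed

section \<open>Irreducible Coxeter systems\<close>

locale irreducible_coxeter_system =
  fixes n :: nat and m :: "nat \<Rightarrow> nat \<Rightarrow> enat"
  assumes coxeter_matrix: "coxeter_matrix n m"
    and irreducible: "irreducible_coxeter n m"
begin

abbreviation edges :: "(nat \<times> nat) set" where
  "edges \<equiv> parcs (coxeter_graph n m)"

lemma m_sym: "i < n \<Longrightarrow> j < n \<Longrightarrow> m i j = m j i"
  and m_diag: "i < n \<Longrightarrow> m i i = 1"
  and m_ge: "i < n \<Longrightarrow> j < n \<Longrightarrow> i \<noteq> j \<Longrightarrow> 2 \<le> m i j"
  using coxeter_matrix unfolding coxeter_matrix_def by blast+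

lemma edges_iff: "(i, j) \<in> edges \<longleftrightarrow> i < n \<and> j < n \<and> i \<noteq> j \<and> m i j \<noteq> 2"
proof -
  have "3 \<le> m i j \<longleftrightarrow> m i j \<noteq> 2" if "2 \<le> m i j"
    using that by (cases "m i j") (auto simp: numeral_eq_enat)
  then show ?thesis using m_ge by (auto simp: coxeter_graph_def)
qed

lemma edges_sym: "(i, j) \<in> edges \<Longrightarrow> (j, i) \<in> edges"
  using m_sym by (auto simp: edges_iff)

lemma non_edge: "i < n \<Longrightarrow> j < n \<Longrightarrow> i \<noteq> j \<Longrightarrow> (i, j) \<notin> edges \<Longrightarrow> m i j = 2"
  by (simp add: edges_iff)

lemma edge_gens_iff: "(i, j) \<in> edge_gens n m \<longleftrightarrow> (i, j) \<in> edges \<and> i < j"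
  by (auto simp: edge_gens_def edges_iff)

lemma edge_letter_in: "(i, j) \<in> edges \<Longrightarrow> fst (edge_letter i j) \<in> edge_gens n m"
  using edges_sym[of i j] by (auto simp: edge_letter_def edge_gens_iff edges_iff)

sublocale graph: pair_wf_digraph "coxeter_graph n m"
  by unfold_locales (auto simp: coxeter_graph_def)

lemma awalk_arc: "(i, j) \<in> edges \<Longrightarrow> graph.awalk i [(i, j)] j"
  using graph.arc_fst_in_verts graph.arc_snd_in_verts
  by (fastforce simp: graph.awalk_Cons_iff graph.awalk_Nil_iff)

lemma n_pos: "0 < n"
  using irreducible
  by (auto simp: irreducible_coxeter_def connected_def strongly_connected_def coxeter_graph_def)

lemma walk_ex:
  assumes "i < n" "j < n"
  shows "\<exists>p. graph.awalk i p j"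
proof -
  have sym: "symmetric (with_proj (coxeter_graph n m))"
    unfolding symmetric_def using edges_sym by (auto intro: symI)
  have "i \<rightarrow>\<^sup>*\<^bsub>with_proj (coxeter_graph n m)\<^esub> j"
    using irreducible assms graph.reachable_mk_symmetric_eq[OF sym]
    by (auto simp: irreducible_coxeter_def connected_def strongly_connected_def coxeter_graph_def)
  then show ?thesis using graph.reachable_awalk by auto
qed

lemma connected_rtrancl:
  assumes "i < n" "j < n"
  shows "(i, j) \<in> edges\<^sup>*"
proof -
  obtain p where p: "graph.awalk i p j" using walk_ex assms by blast
  then show ?thesis
    by (induction p arbitrary: i) (auto simp: graph.awalk_Nil_iff graph.awalk_Cons_iff
        intro: converse_rtrancl_into_rtrancl)
qed

lemma walk_word_in:
  "graph.awalk u p v \<Longrightarrow> map (\<lambda>(i, j). edge_letter i j) p \<in> words_over (edge_gens n m)"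
  by (induction p arbitrary: u) (auto simp: graph.awalk_Cons_iff edge_letter_in)

end

section \<open>Groups satisfying the edge relations\<close>

text \<open>
  The arguments that use only the edge relations are carried out in an arbitrary group in which they
  hold; the presented group is the instance of interest.
\<close>

locale edge_relation_group = irreducible_coxeter_system n m + group P
  for n m and P :: "('a, 'b) monoid_scheme" (structure) +
  fixes f :: "nat \<times> nat \<Rightarrow> 'a"
  assumes gens: "f \<in> edge_gens n m \<rightarrow> carrier P"
    and relations: "(p, q) \<in> edge_relations n m \<Longrightarrow> p \<in> words_over (edge_gens n m) \<Longrightarrow>
      q \<in> words_over (edge_gens n m) \<Longrightarrow> word_val P f p = word_val P f q"
begin

lemma power_relation:
  assumes "(word_pow w k, []) \<in> edge_relations n m" "w \<in> words_over (edge_gens n m)"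
  shows "word_val P f w [^] k = \<one>"
  using relations[OF assms(1)] word_pow_in_words_over[OF assms(2)] word_val_pow[OF gens assms(2)]
  by simp

definition arc_val :: "nat \<Rightarrow> nat \<Rightarrow> 'a" where
  "arc_val i j = word_val P f [edge_letter i j]"

definition walk_val :: "(nat \<times> nat) list \<Rightarrow> 'a" where
  "walk_val p = word_val P f (map (\<lambda>(i, j). edge_letter i j) p)"

lemma arc_val_closed: "(i, j) \<in> edges \<Longrightarrow> arc_val i j \<in> carrier P"
  unfolding arc_val_def by (rule word_val_closed[OF gens]) (simp add: edge_letter_in)

lemma arc_val_inverse: "(i, j) \<in> edges \<Longrightarrow> arc_val i j \<otimes> arc_val j i = \<one>"
proof -
  assume "(i, j) \<in> edges"
  then have "(min i j, max i j) \<in> edge_gens n m" "i \<noteq> j"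
    using edges_sym by (auto simp: edge_gens_iff edges_iff min_def max_def)
  then show ?thesis using gens
    by (auto simp: arc_val_def edge_letter_def min_def max_def Pi_iff split: if_splits)
qed

lemma walk_val_closed: "graph.awalk u p v \<Longrightarrow> walk_val p \<in> carrier P"
  unfolding walk_val_def by (intro word_val_closed[OF gens] walk_word_in)

lemma walk_val_append:
  "graph.awalk u p v \<Longrightarrow> graph.awalk v q w \<Longrightarrow> walk_val (p @ q) = walk_val p \<otimes> walk_val q"
  unfolding walk_val_def map_append by (intro word_val_append[OF gens] walk_word_in)

lemma walk_val_Nil [simp]: "walk_val [] = \<one>"
  by (simp add: walk_val_def)

lemma walk_val_single: "walk_val [(i, j)] = arc_val i j"
  by (simp add: walk_val_def arc_val_def)

text \<open>
  The relations speak of cycles of the undirected graph. A cycle of the symmetric digraph of length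
  less than three runs along an edge and back, and there the two letters cancel.
\<close>

lemma cycle_val_eq_one:
  assumes "graph.cycle c"
  shows "walk_val c = \<one>"
proof -
  obtain u where u: "graph.awalk u c u" "c \<noteq> []" using assms by (auto simp: graph.cycle_def)
  show ?thesis
  proof (cases "3 \<le> length c")
    case True
    then have "(map (\<lambda>(i, j). edge_letter i j) c, []) \<in> edge_relations n m"
      using assms unfolding edge_relations_def Let_def by blast
    from relations[OF this] show ?thesis using walk_word_in[OF u(1)] by (simp add: walk_val_def)
  next
    case False
    with u obtain a b where "c = [a] \<or> c = [a, b]"
      by (cases c rule: remdups_adj.cases) (auto simp: Suc_le_eq not_less)
    then obtain v where "c = [(u, u)] \<and> (u, u) \<in> edges \<or> c = [(u, v), (v, u)] \<and> (u, v) \<in> edges"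
      using u by (cases a; cases b) (auto simp: graph.awalk_Cons_iff graph.awalk_Nil_iff)
    then show ?thesis
    proof
      assume "c = [(u, u)] \<and> (u, u) \<in> edges"
      then show ?thesis by (simp add: edges_iff)
    next
      assume c: "c = [(u, v), (v, u)] \<and> (u, v) \<in> edges"
      then have "walk_val c = arc_val u v \<otimes> arc_val v u"
        using walk_val_append[of u "[(u, v)]" v "[(v, u)]" u] edges_sym[of u v] walk_val_single
        by (simp add: awalk_arc)
      then show ?thesis using c arc_val_inverse by simp
    qed
  qed
qed

lemma closed_walk_val_eq_one:
  assumes "graph.awalk u p u"
  shows "walk_val p = \<one>"
  using assms
proof (induction rule: graph.closed_walk_induct)
  case (insert q r s v w)
  then have "walk_val (q @ r @ s) = walk_val q \<otimes> walk_val s"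
    using walk_val_append[of v q w "r @ s" v] walk_val_append[of w r w s v]
      graph.awalk_appendI[of w r w s v] walk_val_closed by simp
  then show ?case using insert walk_val_append by metis
qed (simp_all add: cycle_val_eq_one)

text \<open>
  Since closed walks have value one, the value \<open>t i\<close> of a walk from \<open>0\<close> to \<open>i\<close> does not depend on the
  walk, and the walk to \<open>i\<close> followed by the arc \<open>(i, j)\<close> is a walk to \<open>j\<close>.
\<close>

lemma potential_ex:
  "\<exists>t. t \<in> {..<n} \<rightarrow> carrier P \<and> t 0 = \<one> \<and>
     (\<forall>i j. (i, j) \<in> edges \<longrightarrow> arc_val i j = inv t i \<otimes> t j)"
proof -
  define p where "p i = (SOME p. graph.awalk 0 p i)" for i
  have p: "graph.awalk 0 (p i) i" if "i < n" for i
    unfolding p_def using walk_ex[OF n_pos that] by (rule someI_ex)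
  define t where "t i = walk_val (p i)" for i
  have t: "t i \<in> carrier P" if "i < n" for i
    using walk_val_closed p that by (auto simp: t_def)
  have "arc_val i j = inv t i \<otimes> t j" if e: "(i, j) \<in> edges" for i j
  proof -
    have ij: "i < n" "j < n" using e by (auto simp: edges_iff)
    \<comment> \<open>A way back from \<open>j\<close> closes both the chosen walk to \<open>j\<close> and the one through \<open>i\<close>.\<close>
    obtain q where q: "graph.awalk j q 0" using walk_ex ij n_pos by blast
    have arc: "graph.awalk i [(i, j)] j"
      using e by (rule awalk_arc)
    have c: "walk_val q \<in> carrier P" "arc_val i j \<in> carrier P" "t i \<in> carrier P" "t j \<in> carrier P"
      using walk_val_closed[OF q] arc_val_closed[OF e] t ij by auto
    have "t j \<otimes> walk_val q = \<one>"
      unfolding t_def using walk_val_append[OF p q] closed_walk_val_eq_one[of 0]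
        graph.awalk_appendI[OF p q] ij by simp
    moreover have "t i \<otimes> arc_val i j \<otimes> walk_val q = \<one>"
      using walk_val_append[OF p graph.awalk_appendI[OF arc q]] walk_val_append[OF arc q]
        closed_walk_val_eq_one[OF graph.awalk_appendI[OF p graph.awalk_appendI[OF arc q]]] ij c
      by (simp add: walk_val_single m_assoc t_def)
    ultimately have "t i \<otimes> arc_val i j = t j" using c by (metis m_closed inv_equality inv_inv)
    then show ?thesis using c by (metis inv_solve_left m_closed)
  qed
  moreover have "t 0 = \<one>" using closed_walk_val_eq_one p[OF n_pos] by (simp add: t_def)
  ultimately show ?thesis using t by blast
qed

end

locale edge_potential = edge_relation_group +
  fixes t :: "nat \<Rightarrow> 'a"
  assumes t_closed: "i < n \<Longrightarrow> t i \<in> carrier P"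
    and arc_val_eq: "(i, j) \<in> edges \<Longrightarrow> arc_val i j = inv t i \<otimes> t j"
begin

definition diff :: "nat \<Rightarrow> nat \<Rightarrow> 'a" where
  "diff i j = inv t i \<otimes> t j"

lemma diff_closed: "i < n \<Longrightarrow> j < n \<Longrightarrow> diff i j \<in> carrier P"
  by (simp add: diff_def t_closed)

lemma diff_trans: "i < n \<Longrightarrow> j < n \<Longrightarrow> k < n \<Longrightarrow> diff i j \<otimes> diff j k = diff i k"
  by (simp add: diff_def t_closed m_assoc) (simp add: t_closed flip: m_assoc)

lemma diff_self: "i < n \<Longrightarrow> diff i i = \<one>"
  by (simp add: diff_def t_closed)

lemma inv_diff: "i < n \<Longrightarrow> j < n \<Longrightarrow> inv diff i j = diff j i"
  by (simp add: diff_trans diff_self diff_closed inv_equality)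

lemma word_val_edge_letter_Cons:
  "(i, j) \<in> edges \<Longrightarrow> w \<in> words_over (edge_gens n m) \<Longrightarrow>
    word_val P f (edge_letter i j # w) = diff i j \<otimes> word_val P f w"
  using word_val_append[OF gens, of "[edge_letter i j]" w] arc_val_eq[of i j]
  by (simp add: diff_def arc_val_def edge_letter_in)

lemma diff_square_sym:
  assumes "i < n" "j < n" "diff i j \<otimes> diff i j = \<one>"
  shows "diff j i \<otimes> diff j i = \<one>"
  using assms inv_diff[of i j] inv_mult_group[of "diff i j" "diff i j"] diff_closed by simp

text \<open>
  The induction is on the length of any walk from \<open>i\<close> to \<open>j\<close>. For length two and three the claim is a
  relation. In a longer walk let \<open>(i, b)\<close> be the first and \<open>(c, j)\<close> the last arc. If one of \<open>i, b\<close>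
  equals or is adjacent to one of \<open>c, j\<close>, there is a walk of length at most three from \<open>i\<close> to \<open>j\<close>
  and hence a shorter one.
  Otherwise the two arcs are not connected, hence commute, and the induction hypothesis applies to the
  pairs \<open>(b, c)\<close>, \<open>(i, c)\<close> and \<open>(b, j)\<close>.
\<close>

lemma diff_square_eq_one:
  assumes "(i, j) \<in> edges ^^ k" "i < n" "j < n" "m i j = 2"
  shows "diff i j \<otimes> diff i j = \<one>"
  using assms
proof (induction k arbitrary: i j rule: less_induct)
  case (less k)
  have ne: "i \<noteq> j" "(i, j) \<notin> edges"
    using less.prems m_diag[of i] by (auto simp: edges_iff)
  have relator: "diff x y \<otimes> diff x y = \<one>"
    if "(word_pow w 2, []) \<in> edge_relations n m" "w \<in> words_over (edge_gens n m)"
      "word_val P f w = diff x y" "x < n" "y < n" for w x y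
    using power_relation[OF that(1,2)] that diff_closed by (simp add: numeral_2_eq_2)
  have two: "diff x y \<otimes> diff x y = \<one>"
    if "(x, a) \<in> edges" "(a, y) \<in> edges" "x < y" "m x y = 2" for x a y
  proof (rule relator)
    show "(word_pow [edge_letter x a, edge_letter a y] 2, []) \<in> edge_relations n m"
      using that unfolding edge_relations_def Let_def by blast
  qed (use that in \<open>simp_all add: word_val_edge_letter_Cons edge_letter_in diff_trans edges_iff
      diff_closed del: word_val.simps(2)\<close>)
  have three: "diff x y \<otimes> diff x y = \<one>"
    if "(x, a) \<in> edges" "(a, b) \<in> edges" "(b, y) \<in> edges" "x < y" "m x y = 2" for x a b y
  proof (rule relator)
    show "(word_pow [edge_letter x a, edge_letter a b, edge_letter b y] 2, []) \<in> edge_relations n m"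
      using that unfolding edge_relations_def Let_def by blast
  qed (use that in \<open>simp_all add: word_val_edge_letter_Cons edge_letter_in diff_trans edges_iff
      diff_closed del: word_val.simps(2)\<close>)
  consider "k = 0" | "k = 1" | "k = 2" | "k = 3" | l where "k = Suc (Suc l)" "2 \<le> l"
    by (metis One_nat_def Suc_1 numeral_3_eq_3 not_less_eq_eq old.nat.exhaust le0)
  then show ?case
  proof cases
    case 1
    then show ?thesis using less.prems ne by simp
  next
    case 2
    then show ?thesis using less.prems ne by simp
  next
    case 3
    then obtain a where "(i, a) \<in> edges" "(a, j) \<in> edges"
      using less.prems by (auto simp: numeral_2_eq_2)
    then show ?thesis
      using two[of i a j] two[of j a i] diff_square_sym[of j i] less.prems ne edges_sym m_sym
      by (metis linorder_neqE_nat)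
  next
    case 4
    then obtain a b where "(i, a) \<in> edges" "(a, b) \<in> edges" "(b, j) \<in> edges"
      using less.prems by (auto simp: numeral_3_eq_3)
    then show ?thesis
      using three[of i a b j] three[of j b a i] diff_square_sym[of j i] less.prems ne edges_sym m_sym
      by (metis linorder_neqE_nat)
  next
    case 5
    from less.prems(1) 5 obtain c where ic: "(i, c) \<in> edges ^^ Suc l" and cj: "(c, j) \<in> edges"
      by auto
    from relpow_Suc_D2[OF ic] obtain b where ib: "(i, b) \<in> edges" and bc: "(b, c) \<in> edges ^^ l"
      by blast
    have bj: "(b, j) \<in> edges ^^ Suc l" using bc cj by auto
    have n: "b < n" "c < n" using ib cj by (auto simp: edges_iff)
    show ?thesis
    proof (cases "\<exists>x\<in>{i, b}. \<exists>y\<in>{c, j}. x = y \<or> (x, y) \<in> edges")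
      case True
      then obtain x y where xy: "x \<in> {i, b}" "y \<in> {c, j}" "x = y \<or> (x, y) \<in> edges" by blast
      have "\<exists>k\<le>1. (i, x) \<in> edges ^^ k" using xy(1) ib by (auto intro: exI[of _ 0] exI[of _ 1])
      moreover have "\<exists>k\<le>1. (x, y) \<in> edges ^^ k" using xy(3) by (auto intro: exI[of _ 0] exI[of _ 1])
      moreover have "\<exists>k\<le>1. (y, j) \<in> edges ^^ k" using xy(2) cj by (auto intro: exI[of _ 0] exI[of _ 1])
      ultimately obtain k1 k2 k3 where "k1 \<le> 1" "k2 \<le> 1" "k3 \<le> 1"
        "(i, x) \<in> edges ^^ k1" "(x, y) \<in> edges ^^ k2" "(y, j) \<in> edges ^^ k3" by blast
      then have "(i, j) \<in> edges ^^ (k1 + (k2 + k3))" "k1 + (k2 + k3) < k"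
        using 5 by (auto simp: relpow_add)
      then show ?thesis using less by blast
    next
      case False
      then have m: "m i c = 2" "m b c = 2" "m b j = 2"
        using non_edge n less.prems by blast+
      let ?x = "diff i b" and ?y = "diff b c" and ?z = "diff c j"
      have nc: "not_connected n m (i, b) (c, j)" using False by (auto simp: not_connected_def)
      have "([edge_letter i b, edge_letter c j], [edge_letter c j, edge_letter i b])
          \<in> edge_relations n m"
        using ib cj nc unfolding edge_relations_def Let_def by blast
      from relations[OF this] have xz: "?x \<otimes> ?z = ?z \<otimes> ?x"
        using ib cj n less.prems
        by (simp add: word_val_edge_letter_Cons edge_letter_in diff_closed del: word_val.simps(2))
      have y: "?y \<otimes> ?y = \<one>" using less.IH[OF _ bc] 5 n m by simp
      have "diff i c \<otimes> diff i c = \<one>" "diff b j \<otimes> diff b j = \<one>"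
        using less.IH[OF _ ic] less.IH[OF _ bj] 5 n m less.prems by simp_all
      then have "(?x \<otimes> ?y \<otimes> ?z) \<otimes> (?x \<otimes> ?y \<otimes> ?z) = \<one>"
        using n less.prems by (intro square_mult3_eq_one xz y) (simp_all add: diff_closed diff_trans)
      then show ?thesis using n less.prems by (simp add: diff_closed diff_trans)
    qed
  qed
qed

lemma diff_pow_eq_one:
  assumes "i \<le> j" "j < n" "m i j = enat k"
  shows "diff i j [^] k = \<one>"
proof -
  consider "i = j" | "i < j" "(i, j) \<in> edges" | "i \<noteq> j" "(i, j) \<notin> edges"
    using assms by fastforce
  then show ?thesis
  proof cases
    case 1
    then show ?thesis using assms by (simp add: diff_self)
  next
    case 2
    then have "(i, j) \<in> edge_gens n m" by (simp add: edge_gens_iff)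
    then have "(word_pow [edge_letter i j] k, []) \<in> edge_relations n m"
      using assms unfolding edge_relations_def Let_def by blast
    then have "word_val P f [edge_letter i j] [^] k = \<one>"
      using 2 by (intro power_relation) (simp_all add: edge_letter_in)
    then show ?thesis using 2 arc_val_eq by (simp add: arc_val_def diff_def)
  next
    case 3
    then have m: "m i j = 2" using non_edge assms by simp
    then have k: "k = 2" using assms by (simp add: numeral_eq_enat)
    have "i < n" using assms by simp
    then obtain l where "(i, j) \<in> edges ^^ l"
      using connected_rtrancl[of i j] assms by (auto simp: rtrancl_is_UN_relpow)
    from diff_square_eq_one[OF this \<open>i < n\<close> assms(2) m] show ?thesis
      using k \<open>i < n\<close> assms by (simp add: numeral_2_eq_2 diff_closed)
  qed
qed

end

section \<open>Alternating evaluation of words in the Coxeter generators\<close>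

text \<open>
  The flag tells whether the next letter contributes \<open>t i\<close> or its inverse. Both
  exponents of a letter are treated alike, as the Coxeter generators are involutions. When the
  Coxeter relations are respected, the values for the two flags together describe a homomorphism from
  the Coxeter group to the wreath product of \<open>H\<close> with the group of order two.
\<close>

fun alt_val :: "('a, 'c) monoid_scheme \<Rightarrow> (nat \<Rightarrow> 'a) \<Rightarrow> bool \<Rightarrow> nat word \<Rightarrow> 'a" where
  "alt_val H t e [] = \<one>\<^bsub>H\<^esub>"
| "alt_val H t e ((i, b) # w) = (if e then t i else inv\<^bsub>H\<^esub> t i) \<otimes>\<^bsub>H\<^esub> alt_val H t (\<not> e) w"

context group
begin

context
  fixes t :: "nat \<Rightarrow> 'a" and n :: nat
  assumes t: "\<And>i. i < n \<Longrightarrow> t i \<in> carrier G"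
begin

lemma alt_val_closed: "w \<in> words_over {..<n} \<Longrightarrow> alt_val G t e w \<in> carrier G"
proof (induction w arbitrary: e)
  case (Cons a w)
  then show ?case by (cases a) (simp add: t)
qed simp

lemma alt_val_append:
  "u \<in> words_over {..<n} \<Longrightarrow> v \<in> words_over {..<n} \<Longrightarrow>
    alt_val G t e (u @ v) = alt_val G t e u \<otimes> alt_val G t (e \<noteq> odd (length u)) v"
proof (induction u arbitrary: e)
  case (Cons a u)
  then show ?case by (cases a; cases e) (simp_all add: t m_assoc alt_val_closed)
qed (simp add: alt_val_closed)

lemma alt_val_pow:
  assumes "i < n" "j < n"
  shows "alt_val G t e (word_pow [(i, b), (j, c)] k) =
    ((if e then t i else inv t i) \<otimes> (if e then inv t j else t j)) [^] k"
proof (induction k)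
  case (Suc k)
  have "alt_val G t e (word_pow [(i, b), (j, c)] (Suc k)) =
      ((if e then t i else inv t i) \<otimes> (if e then inv t j else t j)) \<otimes>
      alt_val G t e (word_pow [(i, b), (j, c)] k)"
    using assms by (simp add: word_pow_Suc alt_val_closed word_pow_in_words_over t m_assoc)
  also have "\<dots> = ((if e then t i else inv t i) \<otimes> (if e then inv t j else t j)) [^] Suc k"
    unfolding Suc by (rule nat_pow_Suc2[symmetric]) (simp add: assms t)
  finally show ?case .
qed (simp add: word_pow_0)

text \<open>
  Where the flag is \<open>False\<close>, a Coxeter relator contributes a power of \<open>inv t i \<otimes> t j\<close>. Where it is
  \<open>True\<close>, the relator contributes the same power of \<open>t i \<otimes> inv t j\<close>, which is trivial too because this element
  is conjugate to the inverse of the former.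
\<close>

lemma alt_val_pres_eq:
  assumes pow: "\<And>i j k. i \<le> j \<Longrightarrow> j < n \<Longrightarrow> m i j = enat k \<Longrightarrow> (inv t i \<otimes> t j) [^] k = \<one>"
    and "pres_eq {..<n} (coxeter_relations n m) u v"
  shows "even (length u) = even (length v) \<and> alt_val G t e u = alt_val G t e v"
  using assms(2)
proof (induction arbitrary: e rule: pres_eq.induct)
  case (cancel u v x b)
  let ?c = "[(x, b), (x, \<not> b)]"
  have "alt_val G t d (?c @ v) = alt_val G t d v" for d
    using cancel by (cases d) (simp_all add: t alt_val_closed flip: m_assoc)
  moreover have "?c @ v \<in> words_over {..<n}" using cancel by simp
  ultimately have "alt_val G t e (u @ ?c @ v) = alt_val G t e (u @ v)"
    using cancel by (simp only: alt_val_append)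
  then show ?case by simp
next
  case (relation u v p q)
  then obtain i j k where p: "p = word_pow [(i, True), (j, True)] k"
    and ijk: "i \<le> j" "j < n" "m i j = enat k" and q: "q = []"
    by (auto simp: coxeter_relations_def)
  have i: "i < n" using ijk by simp
  have "(t j \<otimes> inv t i) [^] k = \<one>"
    using pow_mult_commute_eq_one[OF _ _ pow[OF ijk]] i ijk t by simp
  then have "inv ((t j \<otimes> inv t i) [^] k) = \<one>" by simp
  then have "(t i \<otimes> inv t j) [^] k = \<one>"
    using i ijk t by (simp add: nat_pow_inv[symmetric] inv_mult_group)
  then have "alt_val G t e p = \<one>" for e
    using pow[OF ijk] by (simp add: p alt_val_pow i ijk)
  moreover have "even (length p)" by (simp add: p length_word_pow)
  ultimately show ?case using relation by (simp add: q alt_val_append alt_val_closed)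
qed auto

end

end

section \<open>The alternating subgroup\<close>

context irreducible_coxeter_system
begin

abbreviation W :: "nat word set monoid" where
  "W \<equiv> coxeter_group n m"

abbreviation s :: "nat \<Rightarrow> nat word set" where
  "s \<equiv> coxeter_gen n m"

abbreviation cls :: "nat word \<Rightarrow> nat word set" where
  "cls \<equiv> pres_class {..<n} (coxeter_relations n m)"

sublocale W: group W
  unfolding coxeter_group_def by (rule group_presented_group)

lemma carrier_W: "carrier W = cls ` words_over {..<n}"
  by (simp add: coxeter_group_def carrier_presented_group)

lemma s_closed: "i < n \<Longrightarrow> s i \<in> carrier W"
  by (auto simp: carrier_W coxeter_gen_def)

lemma cls_eq_word_val: "w \<in> words_over {..<n} \<Longrightarrow> cls w = word_val W s w"
  unfolding coxeter_group_def coxeter_gen_def by (rule pres_class_eq_word_val)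

lemma s_pow:
  assumes "i < n" "j < n" "m i j = enat k"
  shows "(s i \<otimes>\<^bsub>W\<^esub> s j) [^]\<^bsub>W\<^esub> k = \<one>\<^bsub>W\<^esub>"
proof -
  have le: "(s i \<otimes>\<^bsub>W\<^esub> s j) [^]\<^bsub>W\<^esub> k = \<one>\<^bsub>W\<^esub>" if "i \<le> j" "j < n" "m i j = enat k" for i j
  proof -
    let ?w = "[(i, True), (j, True)]"
    have w: "?w \<in> words_over {..<n}" using that by simp
    have s: "s \<in> {..<n} \<rightarrow> carrier W" using s_closed by simp
    have "pres_eq {..<n} (coxeter_relations n m) ([] @ word_pow ?w k @ []) ([] @ [] @ [])"
      using that word_pow_in_words_over[OF w]
      by (intro pres_eq.relation) (auto simp: coxeter_relations_def)
    then have "cls (word_pow ?w k) = cls []"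
      using word_pow_in_words_over[OF w] by (simp add: pres_class_eq_iff)
    then have "word_val W s ?w [^]\<^bsub>W\<^esub> k = \<one>\<^bsub>W\<^esub>"
      using word_pow_in_words_over[OF w] by (simp add: cls_eq_word_val W.word_val_pow[OF s w])
    then show ?thesis using that s_closed by simp
  qed
  show ?thesis
    using assms le[of i j] le[of j i] m_sym[of i j] W.pow_mult_commute_eq_one[of "s j" "s i" k]
      s_closed linear[of i j] by auto
qed

lemma s_square: "i < n \<Longrightarrow> s i \<otimes>\<^bsub>W\<^esub> s i = \<one>\<^bsub>W\<^esub>"
  using s_pow[of i i 1] m_diag[of i] s_closed by (simp add: one_enat_def)

lemma inv_s: "i < n \<Longrightarrow> inv\<^bsub>W\<^esub> s i = s i"
  by (simp add: W.inv_equality s_square s_closed)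

lemma s_cancel: "i < n \<Longrightarrow> x \<in> carrier W \<Longrightarrow> s i \<otimes>\<^bsub>W\<^esub> (s i \<otimes>\<^bsub>W\<^esub> x) = x"
  by (simp add: s_closed s_square flip: W.m_assoc)

lemma s_commute:
  assumes "i < n" "j < n" "m i j = 2"
  shows "s i \<otimes>\<^bsub>W\<^esub> s j = s j \<otimes>\<^bsub>W\<^esub> s i"
proof -
  have "(s i \<otimes>\<^bsub>W\<^esub> s j) \<otimes>\<^bsub>W\<^esub> (s i \<otimes>\<^bsub>W\<^esub> s j) = \<one>\<^bsub>W\<^esub>"
    using s_pow[of i j 2] assms s_closed by (simp add: numeral_eq_enat numeral_2_eq_2)
  then have "inv\<^bsub>W\<^esub> (s i \<otimes>\<^bsub>W\<^esub> s j) = s i \<otimes>\<^bsub>W\<^esub> s j"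
    using assms s_closed by (simp add: W.inv_equality)
  then show ?thesis using assms s_closed by (simp add: W.inv_mult_group inv_s)
qed

lemma cls_closed: "w \<in> words_over {..<n} \<Longrightarrow> cls w \<in> carrier W"
  by (simp add: carrier_W)

lemma cls_Cons: "i < n \<Longrightarrow> w \<in> words_over {..<n} \<Longrightarrow> cls ((i, b) # w) = s i \<otimes>\<^bsub>W\<^esub> cls w"
  by (simp add: cls_eq_word_val inv_s)

lemma cls_Nil: "cls [] = \<one>\<^bsub>W\<^esub>"
  by (simp add: cls_eq_word_val)

lemma sign_cls:
  assumes "w \<in> words_over {..<n}"
  shows "coxeter_sign n m (cls w) = (-1) ^ length w"
proof -
  interpret sign: group_hom W sign_img "coxeter_sign n m"
    using W.is_group group_sign_img coxeter_sign(1)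
    by (simp add: group_hom_def group_hom_axioms_def)
  show ?thesis using assms
  proof (induction w)
    case Nil
    then show ?case using sign.hom_one by (simp add: cls_Nil sign_img_def)
  next
    case (Cons a w)
    then show ?case
      by (cases a) (simp add: cls_Cons s_closed cls_closed coxeter_sign(2), simp add: sign_img_def)
  qed
qed

lemma carrier_alternating_subgroup:
  "carrier (alternating_subgroup n m) = cls ` {w \<in> words_over {..<n}. even (length w)}"
proof -
  have "(-1 :: int) ^ length w = 1 \<longleftrightarrow> even (length w)" for w :: "nat word"
    by (cases "even (length w)") auto
  then show ?thesis
    by (auto simp: alternating_subgroup_def kernel_def carrier_W sign_cls sign_img_def)
qed

definition gen_product :: "nat \<times> nat \<Rightarrow> nat word set" where
  "gen_product = (\<lambda>(i, j). s i \<otimes>\<^bsub>W\<^esub> s j)"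

lemma gen_product_in: "gen_product \<in> edge_gens n m \<rightarrow> carrier W"
  by (auto simp: gen_product_def edge_gens_iff edges_iff s_closed)

lemma word_val_gen_product_Cons:
  assumes "(i, j) \<in> edges"
  shows "word_val W gen_product (edge_letter i j # w) =
    s i \<otimes>\<^bsub>W\<^esub> s j \<otimes>\<^bsub>W\<^esub> word_val W gen_product w"
  using assms
  by (auto simp: edge_letter_def gen_product_def edges_iff W.inv_mult_group s_closed inv_s)

lemma word_val_gen_product_walk:
  "graph.awalk u p v \<Longrightarrow>
    word_val W gen_product (map (\<lambda>(i, j). edge_letter i j) p) = s u \<otimes>\<^bsub>W\<^esub> s v"
proof (induction p arbitrary: u)
  case Nil
  then have "u = v" "u < n"
    by (simp_all only: graph.awalk_Nil_iff) (simp add: coxeter_graph_def)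
  then show ?case by (simp add: s_square)
next
  case (Cons e p)
  then obtain x where e: "e = (u, x)" "(u, x) \<in> edges" and p: "graph.awalk x p v"
    by (cases e) (auto simp: graph.awalk_Cons_iff)
  have "v < n" using p graph.awlast_in_verts by (fastforce simp: coxeter_graph_def)
  then show ?case using e p Cons.IH[OF p]
    by (simp add: word_val_gen_product_Cons edges_iff s_closed W.m_assoc s_cancel)
qed

text \<open>
  A product \<open>(s\<^sub>i s\<^sub>j) (s\<^sub>j s\<^sub>k) \<dots>\<close> along a walk telescopes to the product of the two Coxeter generators
  at its ends, so all relations but the last reduce to the relations of \<open>W\<close>. In the last one, each
  Coxeter generator on the one edge commutes with each on the other.
\<close>

lemma word_val_gen_product_relation:
  assumes "(p, q) \<in> edge_relations n m"
  shows "word_val W gen_product p = word_val W gen_product q"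
proof -
  have pow: "word_val W gen_product (word_pow w k) = \<one>\<^bsub>W\<^esub>"
    if "w \<in> words_over (edge_gens n m)" "word_val W gen_product w = s i \<otimes>\<^bsub>W\<^esub> s j"
      "i < n" "j < n" "m i j = enat k" for w i j k
    using that by (simp add: W.word_val_pow[OF gen_product_in] s_pow)
  from assms consider
    (power) i j k where "(i, j) \<in> edge_gens n m" "m i j = enat k"
      "p = word_pow [edge_letter i j] k" "q = []"
  | (cycle) c where "graph.cycle c" "p = map (\<lambda>(i, j). edge_letter i j) c" "q = []"
  | (two) i j k where "(i, j) \<in> edges" "(j, k) \<in> edges" "m i k = 2"
      "p = word_pow [edge_letter i j, edge_letter j k] 2" "q = []"
  | (three) i j k l where "(i, j) \<in> edges" "(j, k) \<in> edges" "(k, l) \<in> edges" "m i l = 2"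
      "p = word_pow [edge_letter i j, edge_letter j k, edge_letter k l] 2" "q = []"
  | (commute) i j l h where "(i, j) \<in> edges" "(l, h) \<in> edges" "not_connected n m (i, j) (l, h)"
      "p = [edge_letter i j, edge_letter l h]" "q = [edge_letter l h, edge_letter i j]"
    unfolding edge_relations_def Let_def by blast
  then show ?thesis
  proof cases
    case power
    then show ?thesis using pow[of "[edge_letter i j]" i j k]
      by (simp add: edge_gens_iff edge_letter_in edges_iff word_val_gen_product_Cons s_closed)
  next
    case cycle
    then obtain u where u: "graph.awalk u c u" by (auto simp: graph.cycle_def)
    moreover from u have "u \<in> pverts (coxeter_graph n m)" by (simp add: graph.awalk_def)
    then have "u < n" by (simp add: coxeter_graph_def)
    ultimately show ?thesis using cycle by (simp add: word_val_gen_product_walk s_square)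
  next
    case two
    then show ?thesis using pow[of "[edge_letter i j, edge_letter j k]" i k 2]
      by (simp add: edge_letter_in edges_iff word_val_gen_product_Cons s_closed
          W.m_assoc s_cancel numeral_eq_enat)
  next
    case three
    then show ?thesis using pow[of "[edge_letter i j, edge_letter j k, edge_letter k l]" i l 2]
      by (simp add: edge_letter_in edges_iff word_val_gen_product_Cons s_closed
          W.m_assoc s_cancel numeral_eq_enat)
  next
    case commute
    have b: "i < n" "j < n" "l < n" "h < n" using commute by (auto simp: edges_iff)
    have "m x y = 2" if "x \<in> {i, j}" "y \<in> {l, h}" for x y
      using commute that b non_edge[of x y] by (auto simp: not_connected_def)
    then have c: "s x \<otimes>\<^bsub>W\<^esub> s y = s y \<otimes>\<^bsub>W\<^esub> s x" if "x \<in> {i, j}" "y \<in> {l, h}" for x y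
      using that b s_commute[of x y] by auto
    have c': "s x \<otimes>\<^bsub>W\<^esub> (s y \<otimes>\<^bsub>W\<^esub> z) = s y \<otimes>\<^bsub>W\<^esub> (s x \<otimes>\<^bsub>W\<^esub> z)"
      if "x \<in> {i, j}" "y \<in> {l, h}" "z \<in> carrier W" for x y z
      using that b c[of x y] s_closed by (auto simp flip: W.m_assoc)
    have "s i \<otimes>\<^bsub>W\<^esub> (s j \<otimes>\<^bsub>W\<^esub> (s l \<otimes>\<^bsub>W\<^esub> s h)) = s l \<otimes>\<^bsub>W\<^esub> (s h \<otimes>\<^bsub>W\<^esub> (s i \<otimes>\<^bsub>W\<^esub> s j))"
      using b by (simp add: c'[of j l] c[of j h] c'[of i l] c'[of i h] s_closed)
    then show ?thesis using commute b
      by (simp add: word_val_gen_product_Cons s_closed W.m_assoc)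
  qed
qed

text \<open>
  The homomorphism given by \<open>gen_product\<close> on the level of words, which is needed to apply \<open>alt_val\<close>
  to an image. The inverse of \<open>s\<^sub>i s\<^sub>j\<close> is written as \<open>s\<^sub>j s\<^sub>i\<close>.
\<close>

fun expand :: "(nat \<times> nat) word \<Rightarrow> nat word" where
  "expand [] = []"
| "expand (((i, j), b) # w) =
    (if b then [(i, True), (j, True)] else [(j, True), (i, True)]) @ expand w"

lemma expand_in: "w \<in> words_over (edge_gens n m) \<Longrightarrow> expand w \<in> words_over {..<n}"
  by (induction w rule: expand.induct) (auto simp: edge_gens_iff edges_iff)

lemma even_length_expand: "even (length (expand w))"
  by (induction w rule: expand.induct) auto

lemma word_val_gen_product_eq_cls:
  "w \<in> words_over (edge_gens n m) \<Longrightarrow> word_val W gen_product w = cls (expand w)"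
  by (induction w rule: expand.induct)
    (auto simp: cls_Nil cls_Cons gen_product_def edge_gens_iff edges_iff expand_in s_closed
      cls_closed W.m_assoc W.inv_mult_group inv_s)

end

text \<open>
  Alternating evaluation is a left inverse of the homomorphism: the two letters that replace the
  generator \<open>(i, j)\<close> contribute \<open>inv t i \<otimes> t j\<close>, which is its value.
\<close>

lemma (in edge_potential) alt_val_expand:
  "w \<in> words_over (edge_gens n m) \<Longrightarrow> alt_val P t False (expand w) = word_val P f w"
proof (induction w rule: expand.induct)
  case (2 i j b w)
  then have ij: "(i, j) \<in> edges" "i < j" "i < n" "j < n" and w: "w \<in> words_over (edge_gens n m)"
    by (auto simp: edge_gens_iff edges_iff)
  have "f (i, j) = diff i j"
    using arc_val_eq[OF ij(1)] ij gens
    by (auto simp: arc_val_def edge_letter_def diff_def Pi_iff edge_gens_iff)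
  then show ?case
    using 2 ij w inv_diff[of i j]
    by (simp add: alt_val_closed[OF t_closed] expand_in t_closed diff_def m_assoc
        word_val_closed[OF gens])
qed simp

context irreducible_coxeter_system
begin

abbreviation Q :: "(nat \<times> nat) word set monoid" where
  "Q \<equiv> presented_group (edge_gens n m) (edge_relations n m)"

lemma edge_relation_group_Q:
  "edge_relation_group n m Q (pres_gen (edge_gens n m) (edge_relations n m))"
proof -
  interpret Q: group Q by (rule group_presented_group)
  show ?thesis
  proof unfold_locales
    show "pres_gen (edge_gens n m) (edge_relations n m) \<in> edge_gens n m \<rightarrow> carrier Q"
      by (auto simp: carrier_presented_group)
  next
    fix p q assume pq: "(p, q) \<in> edge_relations n m"
      and w: "p \<in> words_over (edge_gens n m)" "q \<in> words_over (edge_gens n m)"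
    have "pres_eq (edge_gens n m) (edge_relations n m) ([] @ p @ []) ([] @ q @ [])"
      using pq w by (intro pres_eq.relation) auto
    then show "word_val Q (pres_gen (edge_gens n m) (edge_relations n m)) p =
        word_val Q (pres_gen (edge_gens n m) (edge_relations n m)) q"
      using w by (simp add: pres_class_eq_iff flip: pres_class_eq_word_val)
  qed
qed

lemma alternating_subgroup_iso: "Q \<cong> alternating_subgroup n m"
proof -
  let ?X = "edge_gens n m" and ?R = "edge_relations n m"
  interpret Q: edge_relation_group n m Q "pres_gen ?X ?R"
    by (rule edge_relation_group_Q)
  obtain t where t: "t \<in> {..<n} \<rightarrow> carrier Q" "t 0 = \<one>\<^bsub>Q\<^esub>"
    and arc: "\<And>i j. (i, j) \<in> edges \<Longrightarrow> Q.arc_val i j = inv\<^bsub>Q\<^esub> t i \<otimes>\<^bsub>Q\<^esub> t j"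
    using Q.potential_ex by blast
  interpret Q: edge_potential n m Q "pres_gen ?X ?R" t
    using t arc by unfold_locales auto
  obtain h where h: "h \<in> hom Q W"
    and h_cls: "\<And>w. w \<in> words_over ?X \<Longrightarrow> h (pres_class ?X ?R w) = cls (expand w)"
    using W.presented_group_hom_ex[OF gen_product_in word_val_gen_product_relation]
      word_val_gen_product_eq_cls by metis
  interpret h: group_hom Q W h
    using h by (simp add: group_hom_def group_hom_axioms_def)
  have alt_cls: "pres_class ?X ?R w = alt_val Q t False (expand w)" if "w \<in> words_over ?X" for w
    using that by (simp add: Q.alt_val_expand pres_class_eq_word_val)
  have alt_eq: "alt_val Q t e u = alt_val Q t e v"
    if "cls u = cls v" "u \<in> words_over {..<n}" for u v e
    using Q.alt_val_pres_eq[OF Q.t_closed Q.diff_pow_eq_one[unfolded Q.diff_def]] that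
    by (simp add: pres_class_eq_iff)
  have inj: "inj_on h (carrier Q)"
  proof (rule inj_onI)
    fix A B assume "A \<in> carrier Q" "B \<in> carrier Q" and eq: "h A = h B"
    then obtain u v where u: "u \<in> words_over ?X" "A = pres_class ?X ?R u"
      and v: "v \<in> words_over ?X" "B = pres_class ?X ?R v"
      by (auto simp: carrier_presented_group)
    then have "cls (expand u) = cls (expand v)" using eq h_cls by simp
    from alt_eq[OF this] show "A = B" using u v by (simp add: alt_cls expand_in)
  qed
  \<comment> \<open>Induction along a path from \<open>0\<close>: appending the arc \<open>(i, j)\<close> multiplies by \<open>s i\<close> and \<open>s j\<close>.\<close>
  have ht: "h (t i) = s 0 \<otimes>\<^bsub>W\<^esub> s i" if "i < n" for i
    using connected_rtrancl[OF n_pos that]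
  proof (induction rule: rtrancl_induct)
    case base
    then show ?case using t(2) n_pos by (simp add: s_square)
  next
    case (step i j)
    have b: "i < n" "j < n" using step by (auto simp: edges_iff)
    have "h (Q.arc_val i j) = s i \<otimes>\<^bsub>W\<^esub> s j"
      using step b h_cls[of "[edge_letter i j]"] edge_letter_in[of i j]
        word_val_gen_product_Cons[of i j "[]"] word_val_gen_product_eq_cls[of "[edge_letter i j]"]
      by (simp add: Q.arc_val_def pres_class_eq_word_val s_closed)
    moreover have "t j = t i \<otimes>\<^bsub>Q\<^esub> Q.arc_val i j"
      using step b arc[of i j] Q.t_closed by (simp flip: Q.m_assoc)
    ultimately show ?case
      using step b Q.t_closed Q.arc_val_closed n_pos by (simp add: s_closed W.m_assoc s_cancel)
  qed
  have alt_closed: "alt_val Q t e w \<in> carrier Q" if "w \<in> words_over {..<n}" for e w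
    using that Q.t_closed Q.alt_val_closed[where t = t and n = n] by blast
  \<comment> \<open>Each letter \<open>i\<close> of \<open>w\<close> becomes \<open>s i\<close> next to an \<open>s 0\<close>, and the copies of \<open>s 0\<close> cancel in pairs.
    One copy is left in front if the evaluation starts with \<open>t\<close>, and one is left at the back if it
    ends with an inverse; for words of even length and flag \<open>False\<close> neither occurs.\<close>
  have h_alt: "h (alt_val Q t e w) \<otimes>\<^bsub>W\<^esub> (if e \<noteq> odd (length w) then s 0 else \<one>\<^bsub>W\<^esub>) =
      (if e then s 0 else \<one>\<^bsub>W\<^esub>) \<otimes>\<^bsub>W\<^esub> cls w" if "w \<in> words_over {..<n}" for e w
    using that
  proof (induction w arbitrary: e)
    case Nil
    then show ?case using n_pos by (simp add: cls_Nil s_closed)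
  next
    case (Cons a w)
    obtain i b where a: "a = (i, b)" by force
    have i: "i < n" and w: "w \<in> words_over {..<n}" using Cons.prems a by simp_all
    have c: "alt_val Q t e' w \<in> carrier Q" for e' using alt_closed w .
    show ?case
      using Cons.IH[OF w, of "\<not> e"] a i w c Q.t_closed n_pos
      by (cases e; cases "odd (length w)")
        (simp_all add: cls_Cons ht W.m_assoc s_closed cls_closed W.inv_mult_group inv_s s_cancel)
  qed
  have "h ` carrier Q = carrier (alternating_subgroup n m)"
  proof (intro equalityI subsetI)
    fix x assume "x \<in> h ` carrier Q"
    then show "x \<in> carrier (alternating_subgroup n m)"
      using h_cls expand_in even_length_expand
      by (auto simp: carrier_presented_group carrier_alternating_subgroup)
  next
    fix x assume "x \<in> carrier (alternating_subgroup n m)"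
    then obtain w where w: "w \<in> words_over {..<n}" "even (length w)" "x = cls w"
      by (auto simp: carrier_alternating_subgroup)
    then have "h (alt_val Q t False w) = x"
      using h_alt[of w False] alt_closed[OF w(1)] by (simp add: cls_closed)
    then show "x \<in> h ` carrier Q" using alt_closed[OF w(1)] by blast
  qed
  moreover from this have "h \<in> hom Q (alternating_subgroup n m)"
    using h by (auto simp: hom_def alternating_subgroup_def)
  ultimately have "h \<in> iso Q (alternating_subgroup n m)"
    using inj by (simp add: iso_def bij_betw_def)
  then show ?thesis by (auto simp: is_iso_def)
qed

end

theorem proposition2p2:
  fixes n :: nat and m :: "nat \<Rightarrow> nat \<Rightarrow> enat"
  assumes "coxeter_matrix n m"
    and "irreducible_coxeter n m"
  shows "alternating_subgroup n m \<cong> presented_group (edge_gens n m) (edge_relations n m)"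
proof -
  interpret irreducible_coxeter_system n m
    using assms by unfold_locales
  show ?thesis
    by (rule group.iso_sym[OF group_presented_group alternating_subgroup_iso])
qed

end
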